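(* Let $q=p^e>4$, where $p$ is a prime, and let $\ell$ be a positive integer with $2\ell\mid e$. Let $V$ be an $r$-dimensional $\mathbb F_p$-subspace of $\mathbb F_{p^\ell}$ with $0\le r<\ell$, let $m$ be a positive integer with $m\mid\frac{q-1}{p^\ell-1}$, let $1\le t\le p^{\ell-r}$, put $n=1+m(tp^r-1)$, and let $s\ge1$. Then, for every integer $k$ with $$s<k\le\left\lfloor\frac{n+p^\ell}{p^\ell+1}\right\rfloor$$ and every integer $h$ with $0\le h\le k-s$, there exists an $[n+s,k]_q$ generalized Roth-Lempel code $C$ such that $\dim(\operatorname{Hull}_{\ell}(C))=h$.
   Context: For $q=p^e$ and $0\le\ell\le e-1$, the $\ell$-Galois inner product on $\mathbb F_q^N$ is $\langle\boldsymbol x,\boldsymbol y\rangle_\ell=\sum_i x_iy_i^{p^\ell}$. For a linear code $C\subseteq\mathbb F_q^N$, $C^{\perp_\ell}=\{\boldsymbol x\in\mathbb F_q^N:\langle\boldsymbol c,\boldsymbol x\rangle_\ell=0\ \text{for all }\boldsymbol c\in C\}$ and $\operatorname{Hull}_\ell(C)=C\cap C^{\perp_\ell}$. An $[n+s,k]_q$ generalized Roth-Lempel (GRL) code, where $1\le s\le k\le n$, is a code of the form $$\operatorname{GRL}_k(\boldsymbol a,\boldsymbol v,A_s)=\{(v_1f(a_1),\ldots,v_nf(a_n),(f_{k-s},\ldots,f_{k-1})A_s): f(x)=\textstyle\sum_{j=0}^{k-1}f_jx^j\in\mathbb F_q[x]\},$$ where $\boldsymbol a\in\mathbb F_q^n$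 has pairwise distinct entries, $\boldsymbol v\in(\mathbb F_q^* )^n$ and $A_s\in\operatorname{GL}_s(\mathbb F_q)$. *)

theory Defs
  imports
    "HOL-Algebra.Embedded_Algebras"
    "HOL-Library.Cardinality"
    "HOL-Computational_Algebra.Computational_Algebra"
    "Jordan_Normal_Form.VS_Connect"
begin

text \<open>
  The finite field \<open>\<F>\<^sub>q\<close> is a type \<open>'a\<close> of classes \<open>field\<close> and \<open>finite\<close>, and \<open>class_ring\<close> is
  the same field as an algebraic structure. Its prime field \<open>\<F>\<^sub>p\<close> consists of the multiples of 1.
  Words of length \<open>N\<close> are the elements of \<open>carrier_vec N\<close>, with coordinates numbered from 0.
\<close>

definition prime_field :: "'a::field set" where
  "prime_field = range of_nat"

definition code_dim :: "nat \<Rightarrow> 'a::field vec set \<Rightarrow> nat" where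
  "code_dim N C =
     vectorspace.dim class_ring ((module_vec TYPE('a) N)\<lparr>carrier := C\<rparr>)"

definition linear_code :: "nat \<Rightarrow> nat \<Rightarrow> 'a::field vec set \<Rightarrow> bool" where
  "linear_code N k C \<longleftrightarrow>
     VectorSpace.subspace class_ring C (module_vec TYPE('a) N) \<and> code_dim N C = k"

text \<open>In the next three definitions \<open>p\<close> is meant to be the characteristic of \<open>'a\<close>.\<close>

definition galois_inner :: "nat \<Rightarrow> nat \<Rightarrow> 'a::field vec \<Rightarrow> 'a vec \<Rightarrow> 'a" where
  "galois_inner p l x y = (\<Sum>i<dim_vec x. x $ i * (y $ i) ^ (p ^ l))"

definition galois_dual :: "nat \<Rightarrow> nat \<Rightarrow> nat \<Rightarrow> 'a::field vec set \<Rightarrow> 'a vec set" where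
  "galois_dual p l N C = {x \<in> carrier_vec N. \<forall>c\<in>C. galois_inner p l c x = 0}"

definition galois_hull :: "nat \<Rightarrow> nat \<Rightarrow> nat \<Rightarrow> 'a::field vec set \<Rightarrow> 'a vec set" where
  "galois_hull p l N C = C \<inter> galois_dual p l N C"

text \<open>
  The row vector \<open>(f\<^bsub>k-s\<^esub>, \<dots>, f\<^bsub>k-1\<^esub>) A\<close> is written as the transpose of \<open>A\<close> applied to a
  column vector. For \<open>k > 0\<close>, the polynomials \<open>\<Sum>j<k. f\<^sub>j x\<^sup>j\<close> are those of degree below \<open>k\<close>.
\<close>

definition GRL_word ::
  "nat \<Rightarrow> nat \<Rightarrow> nat \<Rightarrow> 'a::field vec \<Rightarrow> 'a vec \<Rightarrow> 'a mat \<Rightarrow> 'a poly \<Rightarrow> 'a vec" where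
  "GRL_word n s k a v A f =
     vec n (\<lambda>i. v $ i * poly f (a $ i)) @\<^sub>v
     (transpose_mat A *\<^sub>v vec s (\<lambda>i. coeff f (k - s + i)))"

definition GRL ::
  "nat \<Rightarrow> nat \<Rightarrow> nat \<Rightarrow> 'a::field vec \<Rightarrow> 'a vec \<Rightarrow> 'a mat \<Rightarrow> 'a vec set" where
  "GRL n s k a v A = {GRL_word n s k a v A f | f. degree f < k}"

definition is_GRL_code :: "nat \<Rightarrow> nat \<Rightarrow> nat \<Rightarrow> 'a::field vec set \<Rightarrow> bool" where
  "is_GRL_code n s k C \<longleftrightarrow>
     1 \<le> s \<and> s \<le> k \<and> k \<le> n \<and> linear_code (n + s) k C \<and>
     (\<exists>a\<in>carrier_vec n. \<exists>v\<in>carrier_vec n. \<exists>A\<in>carrier_mat s s.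
        inj_on (\<lambda>i. a $ i) {..<n} \<and> (\<forall>i<n. v $ i \<noteq> 0) \<and> invertible_mat A \<and>
        C = GRL n s k a v A)"

end

theory Submission
  imports Defs
begin

text \<open>
  Let \<open>Q = p\<^sup>l\<close>. The evaluation points are the \<open>x\<close> with \<open>x\<^sup>m \<in> U\<close>, where \<open>U\<close> is a subset of
  \<open>\<F>\<^sub>Q\<close> of size \<open>t p\<^sup>r\<close> containing 0. The derivative of \<open>x \<Prod>\<^bsub>u \<in> U - {0}\<^esub> (x\<^sup>m - u)\<close> takes values in
  \<open>\<F>\<^sub>Q\<close> at these points, so the Lagrange weights \<open>1 / \<Prod>\<^bsub>j \<noteq> i\<^esub> (a\<^sub>i - a\<^sub>j)\<close> are nonzero elements of
  \<open>\<F>\<^sub>Q\<close>, and these are \<open>(Q + 1)\<close>-th powers because \<open>Q\<^sup>2 - 1\<close> divides \<open>q - 1\<close>. If \<open>v\<^sub>i\<^bsup>Q + 1\<^esup>\<close> is the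
  \<open>i\<close>-th weight, then the first \<open>n\<close> coordinates of the words of \<open>g\<close> and \<open>f\<close> contribute the coefficient
  of \<open>g f\<^sup>Q\<close> at \<open>x\<^bsup>n - 1\<^esup>\<close> to their inner product; this is \<open>g\<^bsub>k-1\<^esub> f\<^bsub>k-1\<^esub>\<^sup>Q\<close> or 0. Taking for \<open>A\<close> a multiple
  \<open>b\<close> of the identity with \<open>b\<^bsup>Q + 1\<^esup> \<noteq> -1\<close>, the inner product becomes a nondegenerate diagonal form in
  the top \<open>s\<close> coefficients. Multiplying the first
  \<open>z = k - s - h\<close> of the \<open>v\<^sub>i\<close> by a constant whose \<open>(Q + 1)\<close>-th power is not 1 adds one diagonal term
  \<open>g(a\<^sub>i) f(a\<^sub>i)\<^sup>Q\<close> for each of these \<open>i\<close>. Hence the hull comes from the polynomials of degree below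
  \<open>k - s\<close> that vanish at \<open>z\<close> points, and has dimension \<open>h\<close>.
\<close>

section \<open>Powers in finite fields\<close>

text \<open>Multiplication by \<open>x\<close> permutes \<open>S\<close>, so the nonzero product of
  \<open>S\<close> is unchanged by the factor \<open>x ^ card S\<close>. Applied to the nonzero
  elements of the whole field and of a subfield.\<close>

lemma pow_card_mult_closed:
  fixes S :: "'a::field set"
  assumes "finite S" "0 \<notin> S" "x \<in> S" and closed: "\<And>y. y \<in> S \<Longrightarrow> x * y \<in> S"
  shows "x ^ card S = 1"
proof -
  have "x \<noteq> 0"
    using assms by auto
  then have inj: "inj_on ((*) x) S"
    by (simp add: inj_on_def)
  then have "(*) x ` S = S"
    using assms by (intro card_subset_eq) (auto simp: card_image)
  then have "\<Prod>S = (\<Prod>y\<in>S. x * y)"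
    using prod.reindex[OF inj, of "\<lambda>y. y"] by simp
  also have "\<dots> = x ^ card S * \<Prod>S"
    by (simp add: prod.distrib)
  finally show ?thesis
    using assms by auto
qed

lemma pow_CARD_minus_1:
  fixes x :: "'a::{field,finite}"
  assumes "x \<noteq> 0"
  shows "x ^ (CARD('a) - 1) = 1"
  using pow_card_mult_closed[of "UNIV - {0}" x] assms by (simp add: card_Diff_singleton)

lemma card_power_fibre_le:
  fixes x :: "'a::idom"
  assumes "D > 0"
  shows "card {y. y ^ D = x} \<le> D"
proof -
  let ?f = "monom 1 D - [:x:]"
  have "coeff ?f D = 1"
    using assms by (cases D) auto
  then have "?f \<noteq> 0"
    by (metis coeff_0 zero_neq_one)
  moreover have "degree ?f \<le> D"
    by (intro degree_diff_le) (auto simp: degree_monom_le)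
  ultimately show ?thesis
    using card_poly_roots_bound[of ?f] by (simp add: poly_monom)
qed

text \<open>With M = q - 1, the polynomial X^D - x divides X^M - 1, which vanishes at all M nonzero
  elements. The cofactor has at most M - D roots, which leaves at least D for X^D - x. No generator
  of the multiplicative group is involved.\<close>

lemma card_power_fibre:
  fixes x :: "'a::{field,finite}"
  assumes D: "D dvd CARD('a) - 1" and x: "x ^ ((CARD('a) - 1) div D) = 1"
  shows "card {y. y ^ D = x} = D"
proof (rule antisym)
  define M where "M = CARD('a) - 1"
  have "CARD('a) > 1"
    using card_mono[of UNIV "{0, 1 :: 'a}"] by simp
  then have "M > 0"
    by (simp add: M_def)
  then have "D > 0"
    using D M_def by (metis dvd_0_left gr0I less_numeral_extra(3))
  then show "card {y. y ^ D = x} \<le> D"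
    by (rule card_power_fibre_le)
  have "M div D > 0"
    using D \<open>M > 0\<close> \<open>D > 0\<close> M_def by (simp add: dvd_imp_le div_greater_zero_iff)
  then obtain c where c: "M div D = Suc c"
    by (metis gr0_implies_Suc)
  have M: "M = D * Suc c"
    using D c M_def by (metis dvd_mult_div_cancel)
  let ?f = "monom 1 D - [:x:]" and ?m = "monom 1 M - 1 :: 'a poly"
  obtain R where R: "?m = ?f * R"
  proof
    have "[:x:] ^ Suc c = 1"
      using x c M_def by (simp only: poly_const_pow one_pCons)
    then have "?m = monom 1 D ^ Suc c - [:x:] ^ Suc c"
      by (simp only: M monom_power power_one mult.commute)
    then show "?m = ?f * (\<Sum>p<Suc c. monom 1 D ^ p * [:x:] ^ (c - p))"
      by (simp only: diff_power_eq_sum)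
  qed
  have "coeff ?f D = 1" "coeff ?m M = 1"
    using \<open>D > 0\<close> \<open>M > 0\<close> by (auto simp: coeff_pCons split: nat.split)
  then have nz: "?f \<noteq> 0" "?m \<noteq> 0"
    by (metis coeff_0 zero_neq_one)+
  have "R \<noteq> 0"
    using nz R by auto
  have "degree ?f \<ge> D"
    using \<open>coeff ?f D = 1\<close> by (intro le_degree) simp
  moreover have "degree ?m \<le> M"
    by (intro degree_diff_le) (auto simp: degree_monom_le)
  ultimately have "degree R \<le> M - D"
    using R degree_mult_eq[OF nz(1) \<open>R \<noteq> 0\<close>] by simp
  then have "card {y. poly R y = 0} \<le> M - D"
    using card_poly_roots_bound[OF \<open>R \<noteq> 0\<close>] by linarith
  moreover have "UNIV - {0} \<subseteq> {y. poly ?f y = 0} \<union> {y. poly R y = 0}"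
  proof
    fix y :: 'a assume "y \<in> UNIV - {0}"
    then have "poly ?m y = 0"
      using pow_CARD_minus_1[of y] by (simp add: poly_monom M_def)
    then show "y \<in> {y. poly ?f y = 0} \<union> {y. poly R y = 0}"
      unfolding R by simp
  qed
  then have "M \<le> card ({y. poly ?f y = 0} \<union> {y. poly R y = 0})"
    using card_mono[of _ "UNIV - {0::'a}"] by (simp add: M_def card_Diff_singleton)
  moreover have "D \<le> M"
    using M by simp
  ultimately show "D \<le> card {y. y ^ D = x}"
    using card_Un_le[of "{y. poly ?f y = 0}" "{y. poly R y = 0}"] by (simp add: poly_monom)
qed

text \<open>At most \<open>D\<close> elements have \<open>D\<close>-th power \<open>y\<close>;
  together with 0 they do not exhaust the field.\<close>

lemma exists_nonzero_power_neq:
  fixes y :: "'a::{field,finite}"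
  assumes "0 < D" "Suc D < CARD('a)"
  shows "\<exists>x :: 'a. x \<noteq> 0 \<and> x ^ D \<noteq> y"
proof (rule ccontr)
  assume "\<not> ?thesis"
  then have "UNIV \<subseteq> insert 0 {x. x ^ D = y}"
    by auto
  then have "CARD('a) \<le> Suc (card {x. x ^ D = y})"
    using card_mono[of "insert 0 {x. x ^ D = y}" UNIV]
    by (metis card_insert_if finite le_SucI le_trans)
  then show False
    using card_power_fibre_le[OF assms(1), of y] assms(2) by simp
qed

text \<open>Only 0 lies over 0, and over each nonzero \<open>u\<close> lie exactly \<open>m\<close>
  points by \<open>card_power_fibre\<close>.\<close>

lemma card_power_preimage:
  fixes U :: "'a::{field,finite} set"
  assumes "0 \<in> U" "m > 0" "m dvd CARD('a) - 1"
    and U: "\<And>u. u \<in> U - {0} \<Longrightarrow> u ^ ((CARD('a) - 1) div m) = 1"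
  shows "card {x. x ^ m \<in> U} = 1 + m * (card U - 1)"
proof -
  have "{x. x ^ m \<in> U} = insert 0 (\<Union>u\<in>U - {0}. {x. x ^ m = u})"
    using assms(1,2) by (auto simp: zero_power)
  also have "card \<dots> = Suc (card (\<Union>u\<in>U - {0}. {x. x ^ m = u}))"
    using assms(2) by (intro card_insert_disjoint) auto
  also have "card (\<Union>u\<in>U - {0}. {x. x ^ m = u}) = (\<Sum>u\<in>U - {0}. card {x. x ^ m = u})"
    by (intro card_UN_disjoint) auto
  also have "\<dots> = (\<Sum>u\<in>U - {0}. m)"
    by (intro sum.cong refl card_power_fibre assms)
  finally show ?thesis
    using assms(1) by (simp add: card_Diff_singleton)
qed

text \<open>\<open>N div m\<close> is a multiple of \<open>d\<close>. With d = Q - 1 and N = q - 1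
  this shows that nonzero elements of the subfield are \<open>m\<close>-th powers, both for the
  given \<open>m\<close> and for Q + 1.\<close>

lemma power_div_eq_1:
  fixes x :: "'a::monoid_mult"
  assumes "x ^ d = 1" "d dvd N" "m dvd N div d"
  shows "x ^ (N div m) = 1" "m dvd N"
proof -
  obtain r where "N div d = m * r"
    using assms(3) by blast
  then have N: "N = m * (d * r)"
    using assms(2) by (metis dvd_mult_div_cancel mult.left_commute)
  show "m dvd N"
    by (simp add: N)
  show "x ^ (N div m) = 1"
    by (cases "m = 0") (simp_all add: N power_mult assms(1))
qed

lemma diff_1_dvd_power_diff_1: "x - 1 dvd x ^ d - (1 :: nat)"
proof (cases "x = 0")
  case False
  show ?thesis
  proof (induction d)
    case (Suc d)
    have "x ^ Suc d - 1 = x * (x ^ d - 1) + (x - 1)"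
      using False by (simp add: right_diff_distrib')
    then show ?case
      using Suc by simp
  qed simp
qed (cases d; simp)

section \<open>Polynomials and Lagrange weights\<close>

text \<open>\<open>u\<close> equals its Lagrange interpolant. The numerators of the basis
  polynomials are monic of degree \<open>card I - 1\<close>, and the coefficients there are
  compared.\<close>

lemma sum_lagrange:
  fixes a :: "'i \<Rightarrow> 'a::field" and u :: "'a poly"
  assumes "finite I" "inj_on a I" "degree u < card I"
  shows "(\<Sum>i\<in>I. poly u (a i) / (\<Prod>j\<in>I - {i}. a i - a j)) = coeff u (card I - 1)"
proof -
  let ?P = "\<lambda>i. \<Prod>j\<in>I - {i}. [:- a j, 1:]"
  let ?d = "\<lambda>i. \<Prod>j\<in>I - {i}. a i - a j"
  define L where "L = (\<Sum>i\<in>I. smult (poly u (a i) / ?d i) (?P i))"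
  have deg: "degree (?P i) = card I - 1" if "i \<in> I" for i
    using that assms(1) by (subst degree_prod_eq_sum_degree) auto
  have "u = L"
  proof (rule poly_eqI_degree)
    fix x assume "x \<in> a ` I"
    then obtain i where i: "i \<in> I" "x = a i" by auto
    have "poly L x = (\<Sum>j\<in>I. poly u (a j) / ?d j * (\<Prod>m\<in>I - {j}. a i - a m))"
      by (simp add: L_def poly_sum poly_prod i)
    also have "\<dots> = (\<Sum>j\<in>I. if j = i then poly u x else 0)"
    proof (intro sum.cong refl)
      fix j assume "j \<in> I"
      show "poly u (a j) / ?d j * (\<Prod>m\<in>I - {j}. a i - a m) = (if j = i then poly u x else 0)"
        using i assms(1,2) by (auto simp: prod_zero_iff dest: inj_onD)
    qed
    finally show "poly u x = poly L x"
      using i assms(1) by simp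
  next
    show "degree u < card (a ` I)"
      using assms by (simp add: card_image)
    have "degree L \<le> card I - 1"
      unfolding L_def using deg assms(1)
      by (intro degree_sum_le) (auto intro: order.trans[OF degree_smult_le])
    then show "degree L < card (a ` I)"
      using assms by (simp add: card_image)
  qed
  moreover have "coeff (?P i) (card I - 1) = 1" if "i \<in> I" for i
    using lead_coeff_prod[of "\<lambda>j. [:- a j, 1:]" "I - {i}"] deg[OF that] by simp
  then have "coeff L (card I - 1) = (\<Sum>i\<in>I. poly u (a i) / ?d i)"
    by (simp add: L_def coeff_sum)
  ultimately show ?thesis
    by simp
qed

lemma coeff_mult_le_degree:
  fixes f g :: "'a::comm_semiring_1 poly"
  assumes "degree f \<le> d" "degree g \<le> e"
  shows "coeff (f * g) (d + e) = coeff f d * coeff g e"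
proof (cases "degree f = d \<and> degree g = e")
  case True
  then show ?thesis
    using coeff_mult_degree_sum[of f g] by simp
next
  case False
  then have "degree f < d \<or> degree g < e" "degree f + degree g < d + e"
    using assms by linarith+
  then have "coeff f d * coeff g e = 0" "coeff (f * g) (d + e) = 0"
    using degree_mult_le[of f g] by (auto simp: coeff_eq_0)
  then show ?thesis
    by simp
qed

lemma coeff_power_le_degree:
  fixes f :: "'a::comm_semiring_1 poly"
  assumes "degree f \<le> d"
  shows "coeff (f ^ q) (q * d) = coeff f d ^ q"
proof (induction q)
  case (Suc q)
  have "degree (f ^ q) \<le> q * d"
    using degree_power_le[of f q] assms by (metis le_trans mult.commute mult_le_mono1)
  then show ?case
    using Suc assms by (simp add: coeff_mult_le_degree)
qed simp

lemma prod_linear_dvd: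
  fixes a :: "nat \<Rightarrow> 'a::field"
  assumes "inj_on a {..<z}" "\<And>i. i < z \<Longrightarrow> poly f (a i) = 0"
  shows "(\<Prod>i<z. [:- a i, 1:]) dvd f"
  using assms
proof (induction z)
  case (Suc z)
  have "inj_on a {..<z}"
    using Suc.prems(1) by (rule inj_on_subset) auto
  then obtain g where g: "f = (\<Prod>i<z. [:- a i, 1:]) * g"
    using Suc by (meson dvdE less_Suc_eq)
  have "(\<Prod>i<z. a z - a i) \<noteq> 0"
    using inj_on_eq_iff[OF Suc.prems(1), of z] by auto
  then have "poly g (a z) = 0"
    using Suc.prems(2)[of z] by (simp add: g poly_prod)
  then have "[:- a z, 1:] dvd g"
    by (simp add: poly_eq_0_iff_dvd)
  then show ?case
    unfolding g prod.lessThan_Suc by (intro mult_dvd_mono dvd_refl)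
qed simp

section \<open>Products of differences of evaluation points as values of a derivative\<close>

lemma poly_pderiv_prod_linear:
  fixes S :: "'a::field set"
  assumes "finite S" "x \<in> S"
  shows "poly (pderiv (\<Prod>y\<in>S. [:- y, 1:])) x = (\<Prod>y\<in>S - {x}. x - y)"
  by (subst prod.remove[OF assms]) (simp add: pderiv_mult pderiv_pCons poly_prod del: mult_pCons_left)

text \<open>Both sides vanish on the preimage of \<open>U\<close>, are monic, and have its
  cardinality as degree; the last point for the right side is the assumption
  \<open>card\<close>.\<close>

lemma prod_power_preimage:
  fixes U :: "'a::{field,finite} set"
  assumes "0 \<in> U" "m > 0"
    and card: "card {x. x ^ m \<in> U} = 1 + m * (card U - 1)"
  shows "(\<Prod>x\<in>{x. x ^ m \<in> U}. [:- x, 1:]) =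
    monom 1 1 * pcompose (\<Prod>u\<in>U - {0}. [:- u, 1:]) (monom 1 m)"
    (is "?L = ?R")
proof (rule poly_eqI_degree_lead_coeff)
  let ?S = "{x. x ^ m \<in> U}"
  let ?G = "\<Prod>u\<in>U - {0}. [:- u, 1:]"
  have G: "degree ?G = card U - 1" "?G \<noteq> 0"
    using assms(1) by (subst degree_prod_eq_sum_degree) auto
  have m: "degree (monom (1::'a) m) = m"
    by (simp add: degree_monom_eq)
  have nz: "pcompose ?G (monom 1 m) \<noteq> 0"
    using G m assms(2) by (simp add: pcompose_eq_0_iff)
  have dL: "degree ?L = card ?S"
    by (subst degree_prod_eq_sum_degree) auto
  have dR: "degree ?R = card ?S"
    using nz G m by (subst degree_mult_eq) (auto simp: degree_pcompose degree_monom_eq card mult.commute)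
  have lL: "lead_coeff ?L = 1"
    by (simp add: lead_coeff_prod)
  have lR: "lead_coeff ?R = 1"
    using assms(2) m
    by (simp only: lead_coeff_mult)
      (simp add: lead_coeff_comp lead_coeff_prod degree_monom_eq)
  show "coeff ?L (card ?S) = coeff ?R (card ?S)"
    using dL dR lL lR by simp
  show "degree ?L \<le> card ?S" "degree ?R \<le> card ?S"
    using dL dR by simp_all
  show "poly ?L x = poly ?R x" if "x \<in> ?S" for x
  proof -
    have "poly ?L x = 0"
      using that by (simp add: poly_prod)
    moreover have "poly ?R x = 0"
      using that by (cases "x = 0") (auto simp: poly_prod poly_pcompose poly_monom prod_zero_iff)
    ultimately show ?thesis
      by simp
  qed
qed auto

text \<open>The product is the derivative of X G(X^m) at \<open>x\<close>. The inner derivative m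
  x^(m-1) meets the factor x, so the value is G(u) + m u G'(u) with u = x^m. Thus only u enters,
  which lies in \<open>K\<close> even if \<open>x\<close> does not.\<close>

lemma prod_diff_power_preimage_in:
  fixes K U :: "'a::{field,finite} set"
  assumes one: "1 \<in> K" and diff: "\<And>x y. x \<in> K \<Longrightarrow> y \<in> K \<Longrightarrow> x - y \<in> K"
    and mult: "\<And>x y. x \<in> K \<Longrightarrow> y \<in> K \<Longrightarrow> x * y \<in> K"
    and "U \<subseteq> K" "0 \<in> U" "m > 0" and card: "card {x. x ^ m \<in> U} = 1 + m * (card U - 1)"
    and x: "x ^ m \<in> U"
  shows "(\<Prod>y\<in>{y. y ^ m \<in> U} - {x}. x - y) \<in> K"
proof -
  let ?G = "\<Prod>u\<in>U - {0}. [:- u, 1:]" and ?u = "x ^ m"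
  have zero: "0 \<in> K"
    using diff[OF one one] by simp
  have add: "x + y \<in> K" if "x \<in> K" "y \<in> K" for x y
    using diff[OF that(1) diff[OF zero that(2)]] by simp
  have nat: "of_nat i \<in> K" for i
    by (induction i) (auto intro: zero one add)
  have prod: "prod f S \<in> K" if "\<And>s. s \<in> S \<Longrightarrow> f s \<in> K" for f :: "'a \<Rightarrow> 'a" and S
    using that by (induction S rule: infinite_finite_induct) (auto intro: one mult)
  have G: "poly ?G ?u \<in> K"
    using assms x by (auto simp: poly_prod intro!: prod diff)
  \<comment> \<open>A nonzero \<open>?u\<close> is a root of \<open>?G\<close>, so the derivative is
    again a product of differences in \<open>K\<close>; for \<open>?u = 0\<close> the factor
    \<open>?u\<close> removes the term.\<close>
  have G': "?u * poly (pderiv ?G) ?u \<in> K"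
  proof (cases "?u = 0")
    case False
    then show ?thesis
      using poly_pderiv_prod_linear[of "U - {0}" ?u] assms x
      by (auto intro!: mult prod diff)
  qed (simp add: zero zero_power)
  have "(\<Prod>y\<in>{y. y ^ m \<in> U} - {x}. x - y) =
      poly (pderiv (\<Prod>y\<in>{y. y ^ m \<in> U}. [:- y, 1:])) x"
    using x by (intro poly_pderiv_prod_linear[symmetric]) auto
  also have "\<dots> = poly ?G ?u + of_nat m * (?u * poly (pderiv ?G) ?u)"
    unfolding prod_power_preimage[OF assms(5,6) card]
    using \<open>m > 0\<close> by (cases m) (simp_all add: pderiv_mult pderiv_pcompose pderiv_monom poly_pcompose
        poly_monom)
  also have "\<dots> \<in> K"
    by (intro add mult nat G G')
  finally show ?thesis .
qed

section \<open>Generalized Roth-Lempel codes\<close>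

text \<open>Rank-nullity with trivial kernel. It gives the dimension of both the code and its
  hull.\<close>

lemma linear_code_image:
  fixes T :: "'a::field vec \<Rightarrow> 'a vec"
  assumes closed: "\<And>x. x \<in> carrier_vec d \<Longrightarrow> T x \<in> carrier_vec N"
    and add: "\<And>x y. x \<in> carrier_vec d \<Longrightarrow> y \<in> carrier_vec d \<Longrightarrow> T (x + y) = T x + T y"
    and smult: "\<And>c x. x \<in> carrier_vec d \<Longrightarrow> T (c \<cdot>\<^sub>v x) = c \<cdot>\<^sub>v T x"
    and inj: "\<And>x. x \<in> carrier_vec d \<Longrightarrow> T x = 0\<^sub>v N \<Longrightarrow> x = 0\<^sub>v d"
  shows "linear_code N d (T ` carrier_vec d)"
proof -
  let ?V = "module_vec TYPE('a) d" and ?W = "module_vec TYPE('a) N"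
  interpret V: vec_space "TYPE('a)" d .
  interpret W: vec_space "TYPE('a)" N .
  have hom: "T \<in> LinearCombinations.module_hom class_ring ?V ?W"
    unfolding LinearCombinations.module_hom_def using closed add smult
    by (auto simp: module_vec_simps)
  interpret T: linear_map class_ring ?V ?W T
    by unfold_locales (rule hom)
  have im: "T.imT = T ` carrier_vec d"
    by (simp add: T.im_def module_vec_simps)
  have T0: "T (0\<^sub>v d) = 0\<^sub>v N"
    using T.f0_is_0 by (simp add: module_vec_simps)
  have ker: "T.kerT = {0\<^sub>v d}"
    using inj T0 by (auto simp: T.ker_def module_vec_simps)
  interpret ker: vectorspace class_ring "V.vs T.kerT"
    by (rule V.subspace_is_vs[OF T.kerT_is_subspace])
  \<comment> \<open>The empty set spans the zero space, so the kernel has dimension 0.\<close>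
  have "ker.basis {}"
    unfolding ker.basis_def
  proof (intro conjI)
    show "ker.lin_indpt {}"
      by (simp add: ker.lin_dep_def)
    have "carrier (V.vs T.kerT) = {0\<^sub>v d}"
      by (simp only: ker) simp
    moreover have "ker.span {} = {0\<^sub>v d}"
      by (auto simp: ker.span_def ker.lincomb_def module_vec_simps)
    ultimately show "ker.gen_set {}"
      by (simp only:)
  qed simp
  then have "ker.dim = 0"
    using ker.dim_basis[of "{}"] by simp
  then have "vectorspace.dim class_ring (W.vs T.imT) = d"
    using T.rank_nullity[OF V.fin_dim] V.dim_is_n by simp
  then show ?thesis
    using T.imT_is_subspace unfolding linear_code_def code_dim_def im by simp
qed

text \<open>Identifies coefficient vectors with polynomials, so that
  \<open>linear_code_image\<close> applies to maps defined on polynomials.\<close>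

definition vec_poly :: "'a::field vec \<Rightarrow> 'a poly" where
  "vec_poly c = (\<Sum>i<dim_vec c. monom (c $ i) i)"

lemma coeff_vec_poly: "coeff (vec_poly c) i = (if i < dim_vec c then c $ i else 0)"
  by (simp add: vec_poly_def coeff_sum sum.delta)

lemma vec_poly_add:
  "x \<in> carrier_vec d \<Longrightarrow> y \<in> carrier_vec d \<Longrightarrow> vec_poly (x + y) = vec_poly x + vec_poly y"
  by (rule poly_eqI) (auto simp: coeff_vec_poly)

lemma vec_poly_smult: "vec_poly (c \<cdot>\<^sub>v x) = smult c (vec_poly x)"
  by (rule poly_eqI) (auto simp: coeff_vec_poly)

lemma vec_poly_eq_0:
  assumes "x \<in> carrier_vec d" "vec_poly x = 0"
  shows "x = 0\<^sub>v d"
proof (rule eq_vecI)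
  fix i assume "i < dim_vec (0\<^sub>v d)"
  then show "x $ i = 0\<^sub>v d $ i"
    using assms coeff_vec_poly[of x i] by simp
qed (use assms in simp)

text \<open>The space is described by vanishing coefficients because \<open>degree f < d\<close> has
  no solution for \<open>d = 0\<close>, where the zero polynomial must remain. This matters for a
  hull of dimension 0.\<close>

lemma vec_poly_image: "vec_poly ` carrier_vec d = {f. \<forall>i\<ge>d. coeff f i = 0}"
proof (intro equalityI subsetI)
  fix f :: "'a poly" assume "f \<in> {f. \<forall>i\<ge>d. coeff f i = 0}"
  then have "f = vec_poly (vec d (coeff f))"
    by (intro poly_eqI) (auto simp: coeff_vec_poly)
  then show "f \<in> vec_poly ` carrier_vec d"
    by (rule image_eqI) simp
qed (auto simp: coeff_vec_poly)

section \<open>Words of a generalized Roth-Lempel code and their dependence on the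
  polynomial\<close>

lemma GRL_word_carrier:
  "A \<in> carrier_mat s s \<Longrightarrow> GRL_word n s k a v A f \<in> carrier_vec (n + s)"
  unfolding GRL_word_def by (intro append_carrier_vec mult_mat_vec_carrier[of _ s s]) simp_all

lemma dim_GRL_word: "A \<in> carrier_mat s s \<Longrightarrow> dim_vec (GRL_word n s k a v A f) = n + s"
  by (rule carrier_vecD[OF GRL_word_carrier])

lemma GRL_word_index:
  assumes "A \<in> carrier_mat s s" "i < n + s"
  shows "GRL_word n s k a v A f $ i =
    (if i < n then v $ i * poly f (a $ i)
     else \<Sum>j<s. A $$ (j, i - n) * coeff f (k - s + j))"
proof -
  have "row (transpose_mat A) j \<bullet> vec s (\<lambda>i. coeff f (k - s + i)) =
      (\<Sum>m<s. A $$ (m, j) * coeff f (k - s + m))" if "j < s" for j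
    using assms that by (simp add: scalar_prod_def atLeast0LessThan)
  then show ?thesis
    using assms by (simp add: GRL_word_def)
qed

lemma GRL_word_add:
  assumes "A \<in> carrier_mat s s"
  shows "GRL_word n s k a v A (f + g) = GRL_word n s k a v A f + GRL_word n s k a v A g"
proof (rule eq_vecI)
  fix i assume "i < dim_vec (GRL_word n s k a v A f + GRL_word n s k a v A g)"
  then have i: "i < n + s"
    by (simp add: dim_GRL_word[OF assms])
  have "(\<Sum>j<s. A $$ (j, i - n) * (coeff f (k - s + j) + coeff g (k - s + j))) =
      (\<Sum>j<s. A $$ (j, i - n) * coeff f (k - s + j)) +
      (\<Sum>j<s. A $$ (j, i - n) * coeff g (k - s + j))"
    unfolding distrib_left by (rule sum.distrib)
  then show "GRL_word n s k a v A (f + g) $ i =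
      (GRL_word n s k a v A f + GRL_word n s k a v A g) $ i"
    using i by (simp add: GRL_word_index[OF assms] dim_GRL_word[OF assms] distrib_left)
qed (simp add: dim_GRL_word[OF assms])

lemma GRL_word_smult:
  assumes "A \<in> carrier_mat s s"
  shows "GRL_word n s k a v A (smult c f) = c \<cdot>\<^sub>v GRL_word n s k a v A f"
proof (rule eq_vecI)
  fix i assume "i < dim_vec (c \<cdot>\<^sub>v GRL_word n s k a v A f)"
  then have i: "i < n + s"
    by (simp add: dim_GRL_word[OF assms])
  have "(\<Sum>j<s. A $$ (j, i - n) * (c * coeff f (k - s + j))) =
      c * (\<Sum>j<s. A $$ (j, i - n) * coeff f (k - s + j))"
    unfolding sum_distrib_left by (intro sum.cong refl mult.left_commute)
  then show "GRL_word n s k a v A (smult c f) $ i = (c \<cdot>\<^sub>v GRL_word n s k a v A f) $ i"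
    using i by (simp add: GRL_word_index[OF assms] dim_GRL_word[OF assms])
qed (simp add: dim_GRL_word[OF assms])

text \<open>The first \<open>n\<close> coordinates already force \<open>n\<close> distinct roots on
  a polynomial of degree below \<open>n\<close>.\<close>

lemma GRL_word_eq_0:
  fixes a :: "'a::field vec"
  assumes A: "A \<in> carrier_mat s s" and a: "inj_on (vec_index a) {..<n}" and v: "\<forall>i<n. vec_index v i \<noteq> 0"
    and deg: "degree f < n" and 0: "GRL_word n s k a v A f = 0\<^sub>v (n + s)"
  shows "f = 0"
proof (rule poly_eqI_degree)
  fix x assume "x \<in> vec_index a ` {..<n}"
  then obtain i where i: "i < n" "x = a $ i"
    by auto
  then have "GRL_word n s k a v A f $ i = 0"
    using 0 by simp
  then show "poly f x = poly 0 x"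
    using i v A by (simp add: GRL_word_index)
qed (use deg in \<open>simp_all add: card_image[OF a]\<close>)

text \<open>Multiplication by \<open>P\<close> is injective and keeps the degree below
  \<open>n\<close>, where evaluation is injective. \<open>P = 1\<close> serves for the code, a
  product of linear factors for its hull.\<close>

lemma linear_code_GRL_word_mult:
  fixes a :: "'a::field vec" and P :: "'a poly"
  assumes A: "A \<in> carrier_mat s s" and a: "inj_on (vec_index a) {..<n}" and v: "\<forall>i<n. vec_index v i \<noteq> 0"
    and "P \<noteq> 0" and "d + degree P \<le> n"
  shows "linear_code (n + s) d ((\<lambda>g. GRL_word n s k a v A (g * P)) ` {g. \<forall>i\<ge>d. coeff g i = 0})"
proof -
  have "linear_code (n + s) d ((\<lambda>x. GRL_word n s k a v A (vec_poly x * P)) ` carrier_vec d)"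
  proof (rule linear_code_image)
    fix x :: "'a vec"
    assume x: "x \<in> carrier_vec d" and 0: "GRL_word n s k a v A (vec_poly x * P) = 0\<^sub>v (n + s)"
    show "x = 0\<^sub>v d"
    proof (rule ccontr)
      assume "x \<noteq> 0\<^sub>v d"
      then have nz: "vec_poly x \<noteq> 0"
        using x vec_poly_eq_0 by blast
      have "degree (vec_poly x) < d"
        using nz vec_poly_image[of d] x
        by (metis (mono_tags, lifting) image_eqI leading_coeff_0_iff linorder_not_less mem_Collect_eq)
      then have "degree (vec_poly x * P) < n"
        using assms nz by (simp add: degree_mult_eq)
      then show False
        using GRL_word_eq_0[OF A a v _ 0] nz assms(4) by simp
    qed
  qed (use A in \<open>simp_all add: GRL_word_carrier GRL_word_add GRL_word_smult vec_poly_add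
      vec_poly_smult distrib_right\<close>)
  then show ?thesis
    unfolding vec_poly_image[symmetric] image_image .
qed

lemma linear_code_GRL:
  fixes a :: "'a::field vec"
  assumes A: "A \<in> carrier_mat s s" and a: "inj_on (vec_index a) {..<n}" and v: "\<forall>i<n. vec_index v i \<noteq> 0"
    and "0 < k" "k \<le> n"
  shows "linear_code (n + s) k (GRL n s k a v A)"
proof -
  \<comment> \<open>For \<open>k = 0\<close> the left side would be the zero space and the right
    side empty.\<close>
  have "{f :: 'a poly. \<forall>i\<ge>k. coeff f i = 0} = {f. degree f < k}"
    using \<open>0 < k\<close> by (auto simp: coeff_eq_0 intro!: degree_lessI)
  then have "GRL n s k a v A = (\<lambda>g. GRL_word n s k a v A (g * 1)) ` {g. \<forall>i\<ge>k. coeff g i = 0}"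
    unfolding GRL_def by (simp only: mult_1_right) blast
  then show ?thesis
    using linear_code_GRL_word_mult[OF A a v, of 1 k k] assms by simp
qed

section \<open>The Galois inner product for a scalar matrix, and the resulting hull\<close>

lemma galois_inner_GRL_word:
  fixes a :: "'a::field vec"
  shows "galois_inner p l (GRL_word n s k a v (b \<cdot>\<^sub>m 1\<^sub>m s) g) (GRL_word n s k a v (b \<cdot>\<^sub>m 1\<^sub>m s) f) =
    (\<Sum>i<n. (v $ i) ^ Suc (p ^ l) * poly (g * f ^ (p ^ l)) (a $ i)) +
    (\<Sum>j<s. b ^ Suc (p ^ l) * (coeff g (k - s + j) * coeff f (k - s + j) ^ (p ^ l)))"
proof -
  define w where "w f = GRL_word n s k a v (b \<cdot>\<^sub>m 1\<^sub>m s) f" for f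
  have A: "b \<cdot>\<^sub>m 1\<^sub>m s \<in> carrier_mat s s"
    by simp
  have w1: "w f $ i = v $ i * poly f (a $ i)" if "i < n" for f i
    using that by (simp add: w_def GRL_word_index[OF A])
  have w2: "w f $ (n + j) = b * coeff f (k - s + j)" if "j < s" for f j
  proof -
    have "w f $ (n + j) = (\<Sum>m<s. (b \<cdot>\<^sub>m 1\<^sub>m s) $$ (m, j) * coeff f (k - s + m))"
      using that by (simp add: w_def GRL_word_index[OF A])
    also have "\<dots> = (\<Sum>m<s. if m = j then b * coeff f (k - s + m) else 0)"
      using that by (intro sum.cong) simp_all
    finally show ?thesis
      using that by (simp add: sum.delta)
  qed
  have split: "(\<Sum>i<n + s. F i) = (\<Sum>i<n. F i) + (\<Sum>j<s. F (n + j))" for F :: "nat \<Rightarrow> 'a"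
    by (induction s) (simp_all add: add.assoc)
  have "dim_vec (w g) = n + s"
    unfolding w_def by (rule dim_GRL_word[OF A])
  then have "galois_inner p l (w g) (w f) = (\<Sum>i<n + s. w g $ i * (w f $ i) ^ (p ^ l))"
    by (simp add: galois_inner_def)
  also have "\<dots> = (\<Sum>i<n. w g $ i * (w f $ i) ^ (p ^ l)) +
      (\<Sum>j<s. w g $ (n + j) * (w f $ (n + j)) ^ (p ^ l))"
    by (rule split)
  also have "\<dots> = (\<Sum>i<n. (v $ i) ^ Suc (p ^ l) * poly (g * f ^ (p ^ l)) (a $ i)) +
    (\<Sum>j<s. b ^ Suc (p ^ l) * (coeff g (k - s + j) * coeff f (k - s + j) ^ (p ^ l)))"
    by (intro arg_cong2[where f = "(+)"] sum.cong refl)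
      (simp_all add: w1 w2 power_mult_distrib mult_ac)
  finally show ?thesis
    unfolding w_def .
qed

lemma invertible_smult_one_mat:
  fixes b :: "'a::field"
  assumes "b \<noteq> 0"
  shows "invertible_mat (b \<cdot>\<^sub>m 1\<^sub>m s)"
proof -
  have "inverts_mat (b \<cdot>\<^sub>m 1\<^sub>m s) (inverse b \<cdot>\<^sub>m 1\<^sub>m s)"
    "inverts_mat (inverse b \<cdot>\<^sub>m 1\<^sub>m s) (b \<cdot>\<^sub>m 1\<^sub>m s)"
    using assms by (auto simp: inverts_mat_def intro!: eq_matI)
  then show ?thesis
    unfolding invertible_mat_def by (auto simp: square_mat.simps)
qed

text \<open>Writing c = 1 + (c - 1) splits the sum over the evaluation points: the part with 1 is
  the Lagrange sum of g f^Q for Q = p^l, the part with c - 1 lives on the first \<open>z\<close>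
  points.\<close>

lemma galois_inner_GRL_word_lagrange:
  fixes a v :: "'a::field vec"
  assumes a: "inj_on (vec_index a) {..<n}"
    and v: "\<And>i. i < n \<Longrightarrow>
      v $ i ^ Suc (p ^ l) = (if i < z then c else 1) / (\<Prod>j\<in>{..<n} - {i}. a $ i - a $ j)"
    and "1 \<le> s" "s \<le> k" "k \<le> n" "(k - 1) * Suc (p ^ l) \<le> n - 1" "z \<le> n"
    and g: "degree g < k" and f: "degree f < k"
  shows "galois_inner p l (GRL_word n s k a v (b \<cdot>\<^sub>m 1\<^sub>m s) g) (GRL_word n s k a v (b \<cdot>\<^sub>m 1\<^sub>m s) f) =
    (\<Sum>j<s. (b ^ Suc (p ^ l) + (if j = s - 1 \<and> (k - 1) * Suc (p ^ l) = n - 1 then 1 else 0)) *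
      (coeff g (k - s + j) * coeff f (k - s + j) ^ (p ^ l))) +
    (\<Sum>i<z. (c - 1) / (\<Prod>j\<in>{..<n} - {i}. a $ i - a $ j) *
      (poly g (a $ i) * poly f (a $ i) ^ (p ^ l)))"
proof -
  define w where "w i = (\<Prod>j\<in>{..<n} - {i}. a $ i - a $ j)" for i
  define u where "u = g * f ^ (p ^ l)"
  \<comment> \<open>The Lagrange sum is nonzero only if the degree bound (k-1)(Q+1) of g f^Q reaches
    n - 1; it then involves only the coefficients at index k - 1 = k - s + (s - 1).\<close>
  define \<epsilon> :: "nat \<Rightarrow> 'a" where
    "\<epsilon> j = (if j = s - 1 \<and> (k - 1) * Suc (p ^ l) = n - 1 then 1 else 0)" for j
  define top where "top j = coeff g (k - s + j) * coeff f (k - s + j) ^ (p ^ l)" for j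
  have deg_f: "degree (f ^ (p ^ l)) \<le> p ^ l * (k - 1)"
    using degree_power_le[of f "p ^ l"] f
    by (metis Suc_diff_1 gr_implies_not0 le_trans less_Suc_eq_le mult.commute mult_le_mono1 not_gr_zero)
  have deg_g: "degree g \<le> k - 1"
    using g by simp
  have deg_u: "degree u \<le> (k - 1) * Suc (p ^ l)"
    using degree_mult_le[of g "f ^ (p ^ l)"] deg_f deg_g by (simp add: u_def mult.commute)
  have "coeff u ((k - 1) * Suc (p ^ l)) = coeff g (k - 1) * coeff f (k - 1) ^ (p ^ l)"
    using coeff_mult_le_degree[OF deg_g deg_f] coeff_power_le_degree[of f "k - 1" "p ^ l"] f
    by (simp add: u_def mult.commute)
  then have "coeff u (n - 1) = \<epsilon> (s - 1) * top (s - 1)"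
    using assms(3,4,6) deg_u coeff_eq_0[of u "n - 1"] by (auto simp: \<epsilon>_def top_def)
  also have "\<dots> = (\<Sum>j<s. if j = s - 1 then \<epsilon> j * top j else 0)"
    using assms(3) by (simp add: sum.delta)
  also have "\<dots> = (\<Sum>j<s. \<epsilon> j * top j)"
    by (intro sum.cong) (auto simp: \<epsilon>_def)
  finally have top: "coeff u (n - 1) = (\<Sum>j<s. \<epsilon> j * top j)" .
  have "degree u < card {..<n}"
    using deg_u assms by simp
  then have lag: "(\<Sum>i<n. poly u (a $ i) / w i) = coeff u (n - 1)"
    using sum_lagrange[of "{..<n}" "vec_index a" u] a by (simp add: w_def)
  have "(\<Sum>i<n. v $ i ^ Suc (p ^ l) * poly u (a $ i)) =
      (\<Sum>i<n. poly u (a $ i) / w i + (if i < z then (c - 1) / w i * poly u (a $ i) else 0))"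
  proof (intro sum.cong refl)
    fix i assume "i \<in> {..<n}"
    then have "v $ i ^ Suc (p ^ l) = (if i < z then c else 1) / w i"
      using v by (simp only: w_def lessThan_iff)
    then show "v $ i ^ Suc (p ^ l) * poly u (a $ i) =
        poly u (a $ i) / w i + (if i < z then (c - 1) / w i * poly u (a $ i) else 0)"
      by (simp only:) (simp add: diff_divide_distrib left_diff_distrib)
  qed
  also have "\<dots> = coeff u (n - 1) + (\<Sum>i<n. if i < z then (c - 1) / w i * poly u (a $ i) else 0)"
    by (simp add: sum.distrib lag)
  also have "(\<Sum>i<n. if i < z then (c - 1) / w i * poly u (a $ i) else 0) =
      (\<Sum>i<z. (c - 1) / w i * poly u (a $ i))"
    using \<open>z \<le> n\<close> by (intro sum.mono_neutral_cong_right) auto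
  finally have "(\<Sum>i<n. v $ i ^ Suc (p ^ l) * poly u (a $ i)) =
      (\<Sum>j<s. \<epsilon> j * top j) + (\<Sum>i<z. (c - 1) / w i * poly u (a $ i))"
    unfolding top .
  then show ?thesis
    unfolding galois_inner_GRL_word u_def[symmetric] top_def[symmetric] \<epsilon>_def[symmetric]
      w_def[symmetric] distrib_right sum.distrib
    by (simp add: u_def)
qed

text \<open>The inner product is a diagonal form in the top \<open>s\<close> coefficients and the
  values at the first \<open>z\<close> points, with nonzero diagonal entries. Suitable test
  polynomials show that orthogonality to the code makes all these quantities of \<open>f\<close>
  vanish.\<close>

lemma galois_hull_GRL:
  fixes a v :: "'a::field vec"
  assumes a: "inj_on (vec_index a) {..<n}"
    and v: "\<And>i. i < n \<Longrightarrow>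
      v $ i ^ Suc (p ^ l) = (if i < z then c else 1) / (\<Prod>j\<in>{..<n} - {i}. a $ i - a $ j)"
    and "1 \<le> s" "s \<le> k" "k \<le> n" "(k - 1) * Suc (p ^ l) \<le> n - 1"
    and z: "z \<le> k - s" and "c \<noteq> 1" "b \<noteq> 0" "b ^ Suc (p ^ l) \<noteq> - 1" and "p > 0"
  shows "galois_hull p l (n + s) (GRL n s k a v (b \<cdot>\<^sub>m 1\<^sub>m s)) =
    (\<lambda>g. GRL_word n s k a v (b \<cdot>\<^sub>m 1\<^sub>m s) (g * (\<Prod>i<z. [:- (a $ i), 1:]))) `
      {g. \<forall>i\<ge>k - s - z. coeff g i = 0}"
proof -
  define W where "W = GRL_word n s k a v (b \<cdot>\<^sub>m 1\<^sub>m s)"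
  define P where "P = (\<Prod>i<z. [:- (a $ i), 1:])"
  define \<mu> :: "nat \<Rightarrow> 'a" where "\<mu> j = b ^ Suc (p ^ l) +
    (if j = s - 1 \<and> (k - 1) * Suc (p ^ l) = n - 1 then 1 else 0)" for j
  define \<delta> where "\<delta> i = (c - 1) / (\<Prod>j\<in>{..<n} - {i}. a $ i - a $ j)" for i
  have "z \<le> n" "0 < k"
    using assms by auto
  have inner: "galois_inner p l (W g) (W f) =
      (\<Sum>j<s. \<mu> j * (coeff g (k - s + j) * coeff f (k - s + j) ^ (p ^ l))) +
      (\<Sum>i<z. \<delta> i * (poly g (a $ i) * poly f (a $ i) ^ (p ^ l)))"
    if "degree g < k" "degree f < k" for f g
    unfolding W_def \<mu>_def \<delta>_def
    by (rule galois_inner_GRL_word_lagrange) (use assms \<open>z \<le> n\<close> that in auto)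
  \<comment> \<open>\<open>\<mu> j\<close> is \<open>b ^ Suc (p ^ l)\<close> or one more; the two
    conditions on \<open>b\<close> exclude 0 in these cases.\<close>
  have \<mu>: "\<mu> j \<noteq> 0" for j
    using assms(9,10) eq_neg_iff_add_eq_0[of "b ^ Suc (p ^ l)" 1] by (simp add: \<mu>_def del: power_Suc)
  have \<delta>: "\<delta> i \<noteq> 0" if "i < z" for i
    using that \<open>z \<le> n\<close> assms(8) inj_onD[OF a] by (auto simp: \<delta>_def)
  have inj_z: "inj_on (vec_index a) {..<z}"
    using a \<open>z \<le> n\<close> by (auto intro: inj_on_subset)
  have P: "degree P = z" "P \<noteq> 0"
    unfolding P_def by (subst degree_prod_eq_sum_degree) auto
  define R where "R = {f. degree f < k \<and> (\<forall>g. degree g < k \<longrightarrow> galois_inner p l (W g) (W f) = 0)}"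
  have hull: "galois_hull p l (n + s) (GRL n s k a v (b \<cdot>\<^sub>m 1\<^sub>m s)) = W ` R"
    using GRL_word_carrier[of "b \<cdot>\<^sub>m 1\<^sub>m s" s n k a v]
    by (auto simp: galois_hull_def galois_dual_def GRL_def R_def W_def[symmetric])
  have "R = (\<lambda>g. g * P) ` {g. \<forall>i\<ge>k - s - z. coeff g i = 0}"
  proof (intro equalityI subsetI)
    fix f assume "f \<in> R"
    then have f: "degree f < k" and 0: "\<And>g. degree g < k \<Longrightarrow> galois_inner p l (W g) (W f) = 0"
      by (auto simp: R_def)
    have roots: "poly f (a $ i) = 0" if i: "i < z" for i
    proof -
      \<comment> \<open>This test polynomial vanishes at the other \<open>z - 1\<close> points, and
        its degree is below \<open>k - s\<close>, so a single term of the form survives.\<close>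
      define g where "g = (\<Prod>j\<in>{..<z} - {i}. [:- (a $ j), 1:])"
      have deg: "degree g = z - 1"
        using i unfolding g_def by (subst degree_prod_eq_sum_degree) auto
      then have top: "coeff g (k - s + j) = 0" for j
        using i z by (intro coeff_eq_0) linarith
      have other: "poly g (a $ j) = 0" if "j < z" "j \<noteq> i" for j
        using that by (auto simp: g_def poly_prod prod_zero_iff)
      have "degree g < k"
        using deg i z by linarith
      have "(\<Sum>j<z. \<delta> j * (poly g (a $ j) * poly f (a $ j) ^ (p ^ l))) =
          (\<Sum>j<z. if j = i then \<delta> j * (poly g (a $ j) * poly f (a $ j) ^ (p ^ l)) else 0)"
        by (intro sum.cong refl) (simp add: other)
      then have "galois_inner p l (W g) (W f) = \<delta> i * (poly g (a $ i) * poly f (a $ i) ^ (p ^ l))"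
        unfolding inner[OF \<open>degree g < k\<close> f] using i by (simp add: top)
      then have "\<delta> i * (poly g (a $ i) * poly f (a $ i) ^ (p ^ l)) = 0"
        using 0[OF \<open>degree g < k\<close>] i by simp
      moreover have "poly g (a $ i) \<noteq> 0"
        using inj_onD[OF inj_z] i by (auto simp: g_def poly_prod prod_zero_iff)
      ultimately show ?thesis
        using \<delta>[OF i] by simp
    qed
    have low: "coeff f (k - s + j) = 0" if j: "j < s" for j
    proof -
      \<comment> \<open>The monomial isolates one top coefficient; the sum over the points vanishes
        because \<open>roots\<close> is already known for \<open>f\<close>.\<close>
      define g :: "'a poly" where "g = monom 1 (k - s + j)"
      have "degree g < k"
        using j assms(4) by (simp add: g_def degree_monom_eq)
      have "(\<Sum>m<s. \<mu> m * (coeff g (k - s + m) * coeff f (k - s + m) ^ (p ^ l))) =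
          (\<Sum>m<s. if m = j then \<mu> m * coeff f (k - s + m) ^ (p ^ l) else 0)"
        by (intro sum.cong refl) (simp add: g_def)
      then have "galois_inner p l (W g) (W f) = \<mu> j * coeff f (k - s + j) ^ (p ^ l)"
        unfolding inner[OF \<open>degree g < k\<close> f] using j roots \<open>p > 0\<close> by (simp add: zero_power)
      then show ?thesis
        using 0[OF \<open>degree g < k\<close>] \<mu>[of j] j by simp
    qed
    obtain g where g: "f = g * P"
      using prod_linear_dvd[OF inj_z roots] by (metis P_def dvdE mult.commute)
    have "coeff g i = 0" if i: "i \<ge> k - s - z" for i
    proof (cases "g = 0")
      case False
      then have deg: "degree f = degree g + z" and "f \<noteq> 0"
        using P by (simp_all add: g degree_mult_eq)
      have lead: "coeff f (degree f) \<noteq> 0"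
        using \<open>f \<noteq> 0\<close> by simp
      have "degree f < k - s"
      proof (rule ccontr)
        assume "\<not> degree f < k - s"
        then have "degree f = k - s + (degree f - (k - s))" "degree f - (k - s) < s"
          using f assms(4) by linarith+
        then show False
          using low lead by metis
      qed
      then show ?thesis
        using deg i by (intro coeff_eq_0) linarith
    qed simp
    then show "f \<in> (\<lambda>g. g * P) ` {g. \<forall>i\<ge>k - s - z. coeff g i = 0}"
      using g by (intro image_eqI[of _ _ g]) simp_all
  next
    fix f assume "f \<in> (\<lambda>g. g * P) ` {g. \<forall>i\<ge>k - s - z. coeff g i = 0}"
    then obtain g where g: "f = g * P" "\<And>i. i \<ge> k - s - z \<Longrightarrow> coeff g i = 0"
      by auto
    \<comment> \<open>The alternative \<open>f = 0\<close> is separate since its degree counts as 0,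
      which is not below \<open>k - s\<close> when \<open>k = s\<close>.\<close>
    have deg: "f = 0 \<or> degree f < k - s"
    proof (cases "g = 0")
      case False
      then have "degree g < k - s - z"
        using g(2)[of "degree g"] by (meson leading_coeff_0_iff not_le)
      then show ?thesis
        using P False by (simp add: g(1) degree_mult_eq)
    qed (simp add: g(1))
    have low: "coeff f (k - s + j) = 0" for j
      using deg by (auto intro: coeff_eq_0)
    have roots: "poly f (a $ i) = 0" if "i < z" for i
      using that by (auto simp: g(1) P_def poly_prod prod_zero_iff)
    have "degree f < k"
      using deg \<open>0 < k\<close> by auto
    moreover have "galois_inner p l (W h) (W f) = 0" if "degree h < k" for h
      unfolding inner[OF that \<open>degree f < k\<close>] using roots low \<open>p > 0\<close> by (simp add: zero_power)
    ultimately show "f \<in> R"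
      by (simp add: R_def)
  qed
  then show ?thesis
    unfolding hull by (simp add: image_image W_def P_def)
qed

section \<open>Choice of evaluation points, multipliers and matrix for a prescribed hull
  dimension\<close>

theorem mainTheorem13:
  fixes p e l r m t n s k h :: nat
    and K V :: "'a::{field,finite} set"
  assumes "prime p" and "CARD('a) = p ^ e" and "p ^ e > 4"
    and "l > 0" and "2 * l dvd e"
    and "subfield K class_ring" and "card K = p ^ l"
    and "V \<subseteq> K" and "ring.dimension class_ring r prime_field V" and "r < l"
    and "m > 0" and "m dvd (p ^ e - 1) div (p ^ l - 1)"
    and "1 \<le> t" and "t \<le> p ^ (l - r)"
    and "n = 1 + m * (t * p ^ r - 1)"
    and "s \<ge> 1"
    and "s < k" and "int k \<le> \<lfloor>real (n + p ^ l) / real (p ^ l + 1)\<rfloor>"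
    and "h \<le> k - s"
  shows "\<exists>C :: 'a vec set. is_GRL_code n s k C \<and>
           code_dim (n + s) (galois_hull p l (n + s) C) = h"
proof -
  define Q where "Q = p ^ l"
  define z where "z = k - s - h"
  have "p \<ge> 2"
    using \<open>prime p\<close> by (rule prime_ge_2_nat)
  then have "Q \<ge> 2"
    using \<open>l > 0\<close> self_le_power[of p l] by (simp add: Q_def)
  obtain d where "e = 2 * l * d"
    using \<open>2 * l dvd e\<close> by blast
  then have CARD: "CARD('a) = (Q ^ 2) ^ d"
    using assms(2) by (simp add: Q_def power_mult[symmetric] mult_ac)
  have CARD_gt: "CARD('a) > 4"
    using assms(2,3) by simp
  have "d \<noteq> 0"
    using CARD_gt CARD by (metis One_nat_def not_less numeral_le_one_iff power_0 semiring_norm(69) less_imp_le)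
  have "Q ^ 2 \<le> CARD('a)"
    unfolding CARD using \<open>d \<noteq> 0\<close> \<open>Q \<ge> 2\<close> by (intro self_le_power) auto
  \<comment> \<open>For Q = 2 the numbers Q + 2 and Q^2 coincide; there q > 4 gives the strict bound
    Q + 2 < q from which \<open>b\<close> and \<open>c\<close> are obtained.\<close>
  moreover have "Q = 2 \<or> Suc (Suc Q) < Q ^ 2"
  proof (cases "Q = 2")
    case False
    then have "3 * Q \<le> Q ^ 2"
      using \<open>Q \<ge> 2\<close> by (simp add: power2_eq_square)
    then show ?thesis
      using False \<open>Q \<ge> 2\<close> by linarith
  qed simp
  ultimately have Q_less: "Suc (Suc Q) < CARD('a)"
    using CARD_gt by auto

  have "Q ^ 2 - 1 = (Q - 1) * Suc Q"
    using \<open>Q \<ge> 2\<close> by (simp add: power2_eq_square algebra_simps)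
  then have SQ: "(Q - 1) * Suc Q dvd CARD('a) - 1"
    using diff_1_dvd_power_diff_1[of "Q ^ 2" d] CARD by simp
  then have Q1: "Q - 1 dvd CARD('a) - 1"
    by (rule dvd_mult_left)
  \<comment> \<open>By this divisibility every nonzero element of \<open>K\<close> is a (Q+1)-th
    power in the whole field.\<close>
  have Suc_Q_dvd: "Suc Q dvd (CARD('a) - 1) div (Q - 1)"
    using SQ \<open>Q \<ge> 2\<close> by (metis Q1 dvd_div_iff_mult dvd_mult_div_cancel mult.commute
       diff_is_0_eq not_less_eq_eq numeral_2_eq_2 One_nat_def)
  have m_dvd: "m dvd (CARD('a) - 1) div (Q - 1)"
    using assms(2,12) by (simp add: Q_def)

  have K: "subring K (class_ring :: 'a ring)"
    using assms(6) by (intro subcring.axioms(1) subdomain.axioms(1) subfield.axioms(1))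
  have K_one: "1 \<in> K" and K_mult: "\<And>x y. x \<in> K \<Longrightarrow> y \<in> K \<Longrightarrow> x * y \<in> K"
    and K_zero: "0 \<in> K"
    and K_add: "\<And>x y. x \<in> K \<Longrightarrow> y \<in> K \<Longrightarrow> x + y \<in> K"
    using subringE[OF K] by simp_all
  have K_minus: "- x \<in> K" if "x \<in> K" for x
    using subringE(5)[OF K that] by (simp add: class_ring_simps)
  have K_diff: "x - y \<in> K" if "x \<in> K" "y \<in> K" for x y
    using K_add[OF that(1) K_minus[OF that(2)]] by simp
  have K_unit: "x ^ (Q - 1) = 1" if "x \<in> K" "x \<noteq> 0" for x
    using pow_card_mult_closed[of "K - {0}" x] that K_mult K_zero assms(7)
    by (simp add: card_Diff_singleton Q_def)

  \<comment> \<open>The bound on \<open>t\<close> gives t p^r <= p^(l-r) p^r = Q, so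
    \<open>K\<close> has room for \<open>U\<close>.\<close>
  have tp: "t * p ^ r \<le> Q" "t * p ^ r \<ge> 1"
    using mult_le_mono1[OF assms(14), of "p ^ r"] assms(10,13) \<open>p \<ge> 2\<close>
    by (simp_all add: Q_def power_add[symmetric])
  then have "t * p ^ r - 1 \<le> card (K - {0})"
    using K_zero assms(7) by (simp add: card_Diff_singleton Q_def)
  then obtain U' where U': "U' \<subseteq> K - {0}" "card U' = t * p ^ r - 1"
    using obtain_subset_with_card_n by metis
  define U where "U = insert 0 U'"
  have "0 \<notin> U'"
    using U'(1) by auto
  then have card_U: "card U = Suc (t * p ^ r - 1)"
    using U'(2) by (simp add: U_def)
  have U: "U \<subseteq> K" "0 \<in> U"
    using U'(1) K_zero by (auto simp: U_def)
  define S where "S = {x. x ^ m \<in> U}"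
  have card_S: "card S = 1 + m * (card U - 1)"
    unfolding S_def
  proof (rule card_power_preimage)
    show "m dvd CARD('a) - 1"
      using power_div_eq_1(2)[of "1 :: 'a", OF _ Q1 m_dvd] by simp
    show "u ^ ((CARD('a) - 1) div m) = 1" if "u \<in> U - {0}" for u
      using that U(1) by (intro power_div_eq_1(1)[OF K_unit Q1 m_dvd]) auto
  qed (use U assms(11) in auto)
  then have "card S = n"
    using card_U assms(15) by simp
  then obtain f where f: "bij_betw f {..<n} S"
    using ex_bij_betw_nat_finite[of S] by (auto simp: atLeast0LessThan)
  define a where "a = vec n f"
  have a: "inj_on (vec_index a) {..<n}"
    using f by (auto simp: a_def bij_betw_def inj_on_def)

  define w where "w i = (\<Prod>j\<in>{..<n} - {i}. a $ i - a $ j)" for i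
  have w: "w i \<in> K" "w i \<noteq> 0" if i: "i < n" for i
  proof -
    have "w i = (\<Prod>j\<in>{..<n} - {i}. f i - f j)"
      using i by (simp add: w_def a_def)
    also have "\<dots> = (\<Prod>y\<in>S - {f i}. f i - y)"
    proof (rule prod.reindex_bij_betw)
      show "bij_betw f ({..<n} - {i}) (S - {f i})"
        using f i by (intro bij_betw_DiffI) (auto simp: bij_betw_def)
    qed
    also have "\<dots> \<in> K"
      unfolding S_def
    proof (rule prod_diff_power_preimage_in)
      show "f i ^ m \<in> U"
        using bij_betwE[OF f] i by (auto simp: S_def)
    qed (use K_one K_diff K_mult U assms(11) card_S in \<open>auto simp: S_def\<close>)
    finally show "w i \<in> K" .
    show "w i \<noteq> 0"
      using inj_on_eq_iff[OF a] i by (auto simp: w_def)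
  qed
  \<comment> \<open>\<open>1 / w i\<close> is killed by the exponent Q - 1, hence by (q-1)/(Q+1), so
    its fibre under the (Q+1)-th power has Q + 1 elements.\<close>
  have "\<exists>y. y ^ Suc Q = 1 / w i" if "i < n" for i
  proof -
    have "(1 / w i) ^ (Q - 1) = 1"
      using K_unit[OF w[OF that]] by (simp add: power_one_over)
    then have "card {y. y ^ Suc Q = 1 / w i} = Suc Q"
      using power_div_eq_1[OF _ Q1 Suc_Q_dvd] by (intro card_power_fibre) auto
    then show ?thesis
      by (metis (mono_tags, lifting) Collect_empty_eq card.empty nat.distinct(1))
  qed
  then obtain y where y: "\<And>i. i < n \<Longrightarrow> y i ^ Suc Q = 1 / w i"
    by metis

  obtain b :: 'a where b: "b \<noteq> 0" "b ^ Suc Q \<noteq> - 1"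
    using exists_nonzero_power_neq[of "Suc Q"] Q_less by auto
  obtain c :: 'a where c: "c \<noteq> 0" "c ^ Suc Q \<noteq> 1"
    using exists_nonzero_power_neq[of "Suc Q"] Q_less by auto
  \<comment> \<open>The factor \<open>c\<close> multiplies the first \<open>z\<close> weights by
    \<open>c ^ Suc Q\<close>, which differs from 1.\<close>
  define v where "v = vec n (\<lambda>i. (if i < z then c else 1) * y i)"
  define A where "A = b \<cdot>\<^sub>m 1\<^sub>m s"
  have v: "v $ i ^ Suc (p ^ l) =
      (if i < z then c ^ Suc Q else 1) / (\<Prod>j\<in>{..<n} - {i}. a $ i - a $ j)" if "i < n" for i
    unfolding Q_def[symmetric] w_def[symmetric]
    using that by (simp only: v_def index_vec power_mult_distrib y[OF that]) simp
  have v_nz: "\<forall>i<n. vec_index v i \<noteq> 0"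
  proof (intro allI impI)
    fix i assume i: "i < n"
    then have "y i \<noteq> 0"
      using y[OF i] w(2)[OF i] by auto
    then show "vec_index v i \<noteq> 0"
      using i c by (simp add: v_def)
  qed
  have A: "A \<in> carrier_mat s s" "invertible_mat A"
    using b by (simp_all add: A_def invertible_smult_one_mat)

  \<comment> \<open>The floor bound amounts to (k-1)(Q+1) <= n - 1, so that g f^Q has degree below
    \<open>n\<close> and the Lagrange identity applies.\<close>
  have "real k \<le> real (n + Q) / real (Q + 1)"
    using assms(18) by (simp add: le_floor_iff Q_def)
  then have "real (k * (Q + 1)) \<le> real (n + Q)"
    by (simp add: pos_le_divide_eq algebra_simps)
  then have "k * (Q + 1) \<le> n + Q"
    by (simp only: of_nat_le_iff)
  then have "(k - 1) * (Q + 1) + (Q + 1) \<le> n + Q"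
    using assms(17) by (cases k) simp_all
  then have k_bound: "(k - 1) * Suc Q \<le> n - 1"
    by simp
  have "k - 1 \<le> (k - 1) * Suc Q"
    by simp
  then have "k \<le> n"
    using k_bound assms(15,17) by linarith

  have "linear_code (n + s) k (GRL n s k a v A)"
    using A a v_nz \<open>k \<le> n\<close> assms(17) by (intro linear_code_GRL) auto
  then have "is_GRL_code n s k (GRL n s k a v A)"
    unfolding is_GRL_code_def
    using assms(16,17) \<open>k \<le> n\<close> a v_nz A
    by (intro conjI bexI[of _ a] bexI[of _ v] bexI[of _ A]) (auto simp: a_def v_def)
  moreover have "code_dim (n + s) (galois_hull p l (n + s) (GRL n s k a v A)) = h"
  proof -
    let ?P = "\<Prod>i<z. [:- (a $ i), 1:]"
    have P: "degree ?P = z" "?P \<noteq> 0"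
      by (subst degree_prod_eq_sum_degree) auto
    \<comment> \<open>The degree condition holds because h + z = k - s, which is at most
      \<open>n\<close>.\<close>
    have "linear_code (n + s) h
        ((\<lambda>g. GRL_word n s k a v A (g * ?P)) ` {g. \<forall>i\<ge>h. coeff g i = 0})"
      using P \<open>k \<le> n\<close> assms(19) by (intro linear_code_GRL_word_mult A a v_nz) (auto simp: z_def)
    moreover have "galois_hull p l (n + s) (GRL n s k a v A) =
        (\<lambda>g. GRL_word n s k a v A (g * ?P)) ` {g. \<forall>i\<ge>k - s - z. coeff g i = 0}"
      unfolding A_def
      using assms(16,17) \<open>k \<le> n\<close> k_bound b c \<open>p \<ge> 2\<close>
      by (intro galois_hull_GRL[OF a v]) (auto simp: z_def Q_def)
    moreover have "k - s - z = h"
      using assms(19) by (simp add: z_def)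
    ultimately show ?thesis
      by (simp add: linear_code_def)
  qed
  ultimately show ?thesis
    by blast
qed

end
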